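(* Let $E=(\mathbb{R}^2,B_E)$ and $F=(\mathbb{R}^2,B_F)$ be two non-isometric $2$-dimensional normed spaces satisfying $B_E\subset B_F\subset d(E,F)\,B_E$. For $\lambda\in(0,1)$ put $$B_\lambda=\bigl(d(E,F)^\lambda B_E\bigr)\cap B_F,\qquad C_\lambda=\mathrm{Conv}\Bigl[B_E\cup \tfrac{1}{d(E,F)^{1-\lambda}}B_F\Bigr].$$ Then for each $\lambda\in(0,1)$ the set of normed spaces $X=(\mathbb{R}^2,B_X)$ with $C_\lambda\subset B_X\subset B_\lambda$ contains uncountably many pairwise non-isometric spaces.
   Context: All normed spaces are real. For normed spaces $E,F$ of the same finite dimension, the (multiplicative) Banach-Mazur distance is $d(E,F)=\inf\{\|T\|\,\|T^{-1}\| : T:E\to F \text{ is an isomorphism}\}$. A normed space written $(\mathbb{R}^2,B)$ is $\mathbb{R}^2$ with the norm whose closed unit ball is the symmetric convex body $B$. $\mathrm{Conv}(S)$ is the convex hull of $S$. *)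

theory Defs
  imports "HOL-Analysis.Analysis"
begin

definition symmetric_convex_body :: "'a::euclidean_space set \<Rightarrow> bool" where
  "symmetric_convex_body B \<longleftrightarrow>
     convex B \<and> compact B \<and> interior B \<noteq> {} \<and> (\<forall>x\<in>B. - x \<in> B)"

text \<open>
  A normed space \<open>(V, B)\<close> is represented by its closed unit ball \<open>B\<close>; its norm is the
  Minkowski functional of \<open>B\<close>. The lemmas below show that for a symmetric convex body
  this is a norm and that its closed unit ball is exactly \<open>B\<close>.
\<close>

definition body_norm :: "'a::real_vector set \<Rightarrow> 'a \<Rightarrow> real" where
  "body_norm B x = Inf {t. t > 0 \<and> x \<in> (*\<^sub>R) t ` B}"

text \<open>
  The next three notions take the norms (as functions) as arguments. In finite dimension
  every linear map is bounded, so the supremum is over a nonempty set bounded above and every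
  linear bijection is an isomorphism of normed spaces.
\<close>

definition operator_norm :: "('a::real_vector \<Rightarrow> real) \<Rightarrow> ('b::real_vector \<Rightarrow> real) \<Rightarrow> ('a \<Rightarrow> 'b) \<Rightarrow> real" where
  "operator_norm N M T = Sup {M (T x) | x. N x \<le> 1}"

definition banach_mazur :: "('a::euclidean_space \<Rightarrow> real) \<Rightarrow> ('b::euclidean_space \<Rightarrow> real) \<Rightarrow> real" where
  "banach_mazur N M =
     Inf {operator_norm N M T * operator_norm M N (inv T) | T. linear T \<and> bij T}"

definition isometric :: "('a::real_vector \<Rightarrow> real) \<Rightarrow> ('b::real_vector \<Rightarrow> real) \<Rightarrow> bool" where
  "isometric N M \<longleftrightarrow> (\<exists>T. linear T \<and> bij T \<and> (\<forall>x. M (T x) = N x))"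


lemma symmetric_convex_body_zero_interior:
  assumes "symmetric_convex_body B"
  shows "0 \<in> interior B"
proof -
  from assms obtain x where x: "x \<in> interior B"
    by (auto simp: symmetric_convex_body_def)
  have "uminus ` B = B"
    using assms by (force simp: symmetric_convex_body_def image_iff)
  then have "- x \<in> interior B"
    using x interior_negations[of B] by auto
  then have "(1/2) *\<^sub>R x + (1/2) *\<^sub>R (- x) \<in> interior B"
    using x assms convex_interior[of B]
    by (intro convexD) (auto simp: symmetric_convex_body_def)
  then show ?thesis by simp
qed

lemma body_norm_set_bdd_below: "bdd_below {t. t > 0 \<and> x \<in> (*\<^sub>R) t ` B}"
  by (rule bdd_belowI[of _ 0]) auto

lemma body_norm_set_nonempty:
  assumes "symmetric_convex_body B"
  shows "{t. t > 0 \<and> x \<in> (*\<^sub>R) t ` B} \<noteq> {}"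
proof -
  obtain e where e: "e > 0" "cball 0 e \<subseteq> B"
    using symmetric_convex_body_zero_interior[OF assms] mem_interior_cball by blast
  define t where "t = (norm x + 1) / e"
  have t: "t > 0" using e by (simp add: t_def add_nonneg_pos)
  have "norm x / t \<le> e" using e
    by (simp add: t_def divide_simps) (smt (verit) mult_right_mono norm_ge_zero)
  then have "inverse t *\<^sub>R x \<in> B" using e t by (intro subsetD[OF e(2)]) (simp add: divide_inverse mult.commute)
  then have "x \<in> (*\<^sub>R) t ` B" using t by (intro image_eqI[of _ _ "inverse t *\<^sub>R x"]) auto
  with t show ?thesis by blast
qed

lemma body_norm_nonneg:
  assumes "symmetric_convex_body B"
  shows "body_norm B x \<ge> 0"
  unfolding body_norm_def by (rule cInf_greatest[OF body_norm_set_nonempty[OF assms]]) auto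

lemma body_norm_le_iff:
  assumes B: "symmetric_convex_body B" and s: "s > 0"
  shows "body_norm B x \<le> s \<longleftrightarrow> x \<in> (*\<^sub>R) s ` B"
proof
  assume "x \<in> (*\<^sub>R) s ` B"
  then show "body_norm B x \<le> s"
    unfolding body_norm_def using s by (intro cInf_lower body_norm_set_bdd_below) auto
next
  assume le: "body_norm B x \<le> s"
  have conv: "convex B" and cl: "closed B" and z: "0 \<in> B"
    using B symmetric_convex_body_zero_interior[OF B] interior_subset
    by (auto simp: symmetric_convex_body_def compact_imp_closed)
  have step: "inverse u *\<^sub>R x \<in> B" if "u > s" for u
  proof -
    have "body_norm B x < u" using le that by simp
    then obtain t where t: "t > 0" "x \<in> (*\<^sub>R) t ` B" "t < u"
      unfolding body_norm_def
      using cInf_less_iff[OF body_norm_set_nonempty[OF B] body_norm_set_bdd_below] by blast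
    then obtain b where b: "b \<in> B" "x = t *\<^sub>R b" by auto
    have "(1 - t/u) *\<^sub>R 0 + (t/u) *\<^sub>R b \<in> B"
      using t b conv z by (intro convexD) auto
    then show ?thesis using b by (simp add: divide_inverse mult.commute)
  qed
  have "(\<lambda>n. inverse (s + inverse (real (Suc n))) *\<^sub>R x) \<longlonglongrightarrow> inverse (s + 0) *\<^sub>R x"
    using s by (intro tendsto_intros LIMSEQ_inverse_real_of_nat) auto
  moreover have "inverse (s + inverse (real (Suc n))) *\<^sub>R x \<in> B" for n
    by (rule step) simp
  ultimately have "inverse s *\<^sub>R x \<in> B"
    using closed_sequentially[OF cl] by fastforce
  then show "x \<in> (*\<^sub>R) s ` B"
    using s by (intro image_eqI[of _ _ "inverse s *\<^sub>R x"]) auto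
qed

lemma body_norm_ball:
  assumes "symmetric_convex_body B"
  shows "{x. body_norm B x \<le> 1} = B"
  using body_norm_le_iff[OF assms, of 1] by auto

lemma body_norm_eq_0_iff:
  assumes B: "symmetric_convex_body B"
  shows "body_norm B x = 0 \<longleftrightarrow> x = 0"
proof
  assume "x = 0"
  have "0 \<in> B"
    using symmetric_convex_body_zero_interior[OF B] interior_subset by auto
  then have "body_norm B x \<le> s" if "s > 0" for s
    using body_norm_le_iff[OF B that] \<open>x = 0\<close> by force
  then show "body_norm B x = 0"
    using body_norm_nonneg[OF B, of x] by (metis dual_order.antisym field_le_epsilon add_0)
next
  assume 0: "body_norm B x = 0"
  obtain K where K: "\<And>b. b \<in> B \<Longrightarrow> norm b \<le> K" "K > 0"
    using B compact_imp_bounded bounded_pos[of B] by (auto simp: symmetric_convex_body_def)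
  have "norm x \<le> 0 + e" if "e > 0" for e
  proof -
    have "x \<in> (*\<^sub>R) (e/K) ` B"
      using body_norm_le_iff[OF B, of "e/K" x] 0 that K(2) by simp
    then obtain b where b: "b \<in> B" "x = (e/K) *\<^sub>R b" by auto
    then show ?thesis using K(1)[OF b(1)] K(2) that by (simp add: divide_simps)
  qed
  then show "x = 0" using field_le_epsilon[of "norm x" 0] by simp
qed

lemma body_norm_scaleR:
  assumes B: "symmetric_convex_body B"
  shows "body_norm B (c *\<^sub>R x) = \<bar>c\<bar> * body_norm B x"
proof -
  have neg: "- x \<in> B" if "x \<in> B" for x using B that by (simp add: symmetric_convex_body_def)
  have le: "body_norm B (c *\<^sub>R x) \<le> \<bar>c\<bar> * body_norm B x" if c: "c \<noteq> 0" for c x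
  proof -
    have "body_norm B (c *\<^sub>R x) \<le> \<bar>c\<bar> * s" if s: "s > body_norm B x" for s
    proof -
      have s0: "s > 0" using s body_norm_nonneg[OF B, of x] by simp
      then obtain b where b: "b \<in> B" "x = s *\<^sub>R b"
        using body_norm_le_iff[OF B s0, of x] s by auto
      have "c *\<^sub>R x \<in> (*\<^sub>R) (\<bar>c\<bar> * s) ` B"
      proof (cases "c > 0")
        case True then show ?thesis using b by auto
      next
        case False then show ?thesis using b neg[of b] by (intro image_eqI[of _ _ "- b"]) auto
      qed
      then show ?thesis using body_norm_le_iff[OF B, of "\<bar>c\<bar> * s"] c s0 by simp
    qed
    then have "body_norm B (c *\<^sub>R x) / \<bar>c\<bar> \<le> s" if "s > body_norm B x" for s
      using that c by (simp add: divide_simps mult.commute)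
    then have "body_norm B (c *\<^sub>R x) / \<bar>c\<bar> \<le> body_norm B x" by (rule dense_ge)
    then show ?thesis using c by (simp add: divide_simps mult.commute)
  qed
  show ?thesis
  proof (cases "c = 0")
    case True then show ?thesis using body_norm_eq_0_iff[OF B] by auto
  next
    case False
    have "body_norm B x \<le> \<bar>inverse c\<bar> * body_norm B (c *\<^sub>R x)"
      using le[of "inverse c" "c *\<^sub>R x"] False by simp
    then show ?thesis using le[OF False, of x] False by (simp add: divide_simps mult.commute)
  qed
qed

lemma body_norm_triangle:
  assumes B: "symmetric_convex_body B"
  shows "body_norm B (x + y) \<le> body_norm B x + body_norm B y"
proof (rule field_le_epsilon)
  fix e :: real assume e: "e > 0"
  define s t where "s = body_norm B x + e/2" and "t = body_norm B y + e/2"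
  have pos: "s > 0" "t > 0"
    using e body_norm_nonneg[OF B] by (simp_all add: s_def t_def add_nonneg_pos)
  obtain a b where a: "a \<in> B" "x = s *\<^sub>R a" and b: "b \<in> B" "y = t *\<^sub>R b"
    using body_norm_le_iff[OF B pos(1), of x] body_norm_le_iff[OF B pos(2), of y] e
    by (auto simp: s_def t_def)
  have "(s/(s+t)) *\<^sub>R a + (t/(s+t)) *\<^sub>R b \<in> B"
    using B a b pos by (intro convexD) (auto simp: symmetric_convex_body_def add_divide_distrib[symmetric])
  moreover have "x + y = (s+t) *\<^sub>R ((s/(s+t)) *\<^sub>R a + (t/(s+t)) *\<^sub>R b)"
    using a b pos by (simp add: scaleR_right_distrib)
  ultimately have "body_norm B (x + y) \<le> s + t"
    using body_norm_le_iff[OF B, of "s+t"] pos by auto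
  then show "body_norm B (x + y) \<le> body_norm B x + body_norm B y + e"
    by (simp add: s_def t_def)
qed

end

theory Submission
  imports Defs
begin

text \<open>
  Since \<open>d > 1\<close>, the bodies \<open>C\<^sub>\<lambda>\<close> and \<open>B\<^sub>\<lambda>\<close> differ: a point whose \<open>E\<close>-norm is \<open>d\<^sup>\<lambda>\<close> and whose
  \<open>F\<close>-norm is \<open>1\<close> lies in \<open>B\<^sub>\<lambda>\<close> but not in \<open>C\<^sub>\<lambda>\<close>, and if there is no such point, then by
  connectedness of the punctured plane \<open>B\<^sub>\<lambda>\<close> is \<open>B\<^sub>F\<close> or \<open>d\<^sup>\<lambda> B\<^sub>E\<close>; equality with \<open>C\<^sub>\<lambda>\<close> would then
  make \<open>B\<^sub>E\<close> and \<open>B\<^sub>F\<close> homothetic.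

  Between two distinct nested symmetric convex bodies \<open>C \<subset> B\<close> of the plane, let \<open>Z\<close> be the convex
  hull of \<open>C\<close> and of a disc in \<open>B - C\<close> together with its reflection, let \<open>(p, q)\<close> maximise
  \<open>\<bar>det (x, y)\<bar>\<close> on \<open>Z\<close>, and let \<open>W\<close> be the convex hull of \<open>C \<union> {\<plusminus>p, \<plusminus>q}\<close>. Then \<open>W\<close> is strictly
  smaller than \<open>Z\<close>, because \<open>Z\<close> has infinitely many extreme points outside \<open>C\<close>. All bodies
  between \<open>W\<close> and \<open>Z\<close> have the same maximal determinant, so an isometry between two of them has
  determinant \<open>\<plusminus>1\<close> and preserves area. The bodies \<open>Z \<inter> s W\<close> form a chain with strictly increasing
  areas.
\<close>

section \<open>Norms of symmetric convex bodies, and operations producing such bodies\<close>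

lemma isometricD_image:
  assumes X: "symmetric_convex_body X" and Y: "symmetric_convex_body Y"
    and iso: "isometric (body_norm X) (body_norm Y)"
  obtains T where "linear T" "T ` X = Y"
proof -
  obtain T where T: "linear T" "bij T" "\<And>x. body_norm Y (T x) = body_norm X x"
    using iso unfolding isometric_def by blast
  have "T x \<in> Y \<longleftrightarrow> x \<in> X" for x
    using body_norm_le_iff[OF X, of 1 x] body_norm_le_iff[OF Y, of 1 "T x"] T(3)[of x] by simp
  then have "T -` Y = X" by auto
  then have "T ` X = Y" using surj_image_vimage_eq[OF bij_is_surj[OF T(2)], of Y] by simp
  with T(1) show ?thesis by (rule that)
qed

lemma body_norm_antimono:
  assumes B: "symmetric_convex_body B" and C: "symmetric_convex_body C" and sub: "B \<subseteq> C"
  shows "body_norm C x \<le> body_norm B x"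
proof (rule dense_ge)
  fix s assume s: "s > body_norm B x"
  then have s0: "s > 0" using body_norm_nonneg[OF B, of x] by simp
  show "body_norm C x \<le> s"
    using body_norm_le_iff[OF B s0, of x] body_norm_le_iff[OF C s0, of x] s sub by auto
qed

lemma continuous_on_body_norm:
  assumes B: "symmetric_convex_body B"
  shows "continuous_on UNIV (body_norm B)"
proof (rule convex_on_continuous[OF open_UNIV])
  show "convex_on UNIV (body_norm B)"
  proof (rule convex_onI)
    fix t :: real and x y :: 'a
    assume "0 < t" "t < 1"
    then show "body_norm B ((1 - t) *\<^sub>R x + t *\<^sub>R y) \<le> (1 - t) * body_norm B x + t * body_norm B y"
      using body_norm_triangle[OF B, of "(1 - t) *\<^sub>R x" "t *\<^sub>R y"]
      by (simp add: body_norm_scaleR[OF B])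
  qed simp
qed

lemma symmetric_convex_body_scaleR:
  assumes B: "symmetric_convex_body B" and s: "s > 0"
  shows "symmetric_convex_body ((*\<^sub>R) s ` B)"
proof -
  have "inj ((*\<^sub>R) s :: 'a \<Rightarrow> 'a)" using s by (simp add: inj_on_def)
  then have "interior ((*\<^sub>R) s ` B) = (*\<^sub>R) s ` interior B"
    by (intro interior_injective_linear_image linear_scaleR)
  then show ?thesis
    using B by (auto simp: symmetric_convex_body_def convex_scaling compact_scaling
        intro: image_eqI[of _ _ "- _"])
qed

lemma symmetric_convex_body_Int:
  assumes A: "symmetric_convex_body A" and B: "symmetric_convex_body B"
  shows "symmetric_convex_body (A \<inter> B)"
  using assms symmetric_convex_body_zero_interior[OF A] symmetric_convex_body_zero_interior[OF B]
  by (auto simp: symmetric_convex_body_def convex_Int compact_Int)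

lemma symmetric_convex_body_hull_Un:
  assumes B: "symmetric_convex_body B" and S: "compact S" "\<And>x. x \<in> S \<Longrightarrow> - x \<in> S"
  shows "symmetric_convex_body (convex hull (B \<union> S))"
proof -
  have "interior B \<subseteq> interior (convex hull (B \<union> S))"
    by (intro interior_mono) (use hull_subset[of "B \<union> S" convex] in blast)
  moreover have "uminus ` (B \<union> S) \<subseteq> B \<union> S"
    using B S by (auto simp: symmetric_convex_body_def)
  then have "uminus ` (convex hull (B \<union> S)) \<subseteq> convex hull (B \<union> S)"
    by (simp add: convex_hull_linear_image linear_uminus hull_mono)
  ultimately show ?thesis
    using B S by (auto simp: symmetric_convex_body_def compact_Un compact_convex_hull)
qed

section \<open>Balls inside differences of bodies, and strict growth of volume\<close>

text \<open>A convex set with nonempty interior lies in the closure of that interior, so a closed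
  \<open>A\<close> containing \<open>interior B\<close> would contain \<open>B\<close>.\<close>

lemma cball_in_Diff:
  fixes B :: "'a::euclidean_space set"
  assumes "convex B" "interior B \<noteq> {}" "closed A" "\<not> B \<subseteq> A"
  obtains w r where "r > 0" "cball w r \<subseteq> B - A"
proof -
  have "\<not> interior B \<subseteq> A"
  proof
    assume "interior B \<subseteq> A"
    then have "closure (interior B) \<subseteq> A" using \<open>closed A\<close> by (rule closure_minimal)
    then show False
      using assms convex_closure_interior[of B] closure_subset[of B] by auto
  qed
  then obtain w where "w \<in> interior B - A" by blast
  moreover have "open (interior B - A)" using \<open>closed A\<close> by (intro open_Diff open_interior)
  ultimately obtain r where "r > 0" "cball w r \<subseteq> interior B - A"
    using open_contains_cball by blast
  then show ?thesis using that interior_subset by blast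
qed

lemma measure_lebesgue_strict_mono:
  assumes X: "compact X" and Y: "convex Y" "compact Y" "interior Y \<noteq> {}"
    and sub: "X \<subseteq> Y" "\<not> Y \<subseteq> X"
  shows "measure lebesgue X < measure lebesgue Y"
proof -
  obtain w r where wr: "r > 0" "cball w r \<subseteq> Y - X"
    using cball_in_Diff[OF Y(1,3) compact_imp_closed[OF X] sub(2)] by blast
  have "measure lebesgue X \<le> measure lebesgue (Y - cball w r)"
    using wr sub X Y
    by (intro measure_mono_fmeasurable fmeasurable_Diff) (auto simp: lmeasurable_compact fmeasurableD)
  also have "\<dots> = measure lebesgue Y - measure lebesgue (cball w r)"
    using wr Y by (intro measurable_measure_Diff) (auto simp: lmeasurable_compact fmeasurableD)
  also have "\<dots> < measure lebesgue Y"
    using content_cball_pos[OF wr(1), of w] by simp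
  finally show ?thesis .
qed

section \<open>Convex hulls with finitely many added points\<close>

text \<open>A functional separating \<open>w\<close> from \<open>C\<close> still does so after a
  small tilt. Each tilt exposes a different point of the sphere around \<open>w\<close>, and only
  points of \<open>F\<close> can supply these in \<open>convex hull (C \<union> F)\<close>.
  Dimension at least 2 leaves room to tilt.\<close>

lemma not_cball_subset_hull_finite:
  fixes C :: "'a::euclidean_space set"
  assumes dim: "2 \<le> DIM('a)" and C: "symmetric_convex_body C"
    and r: "r > 0" and disj: "cball w r \<inter> C = {}"
    and F: "finite F" "F \<subseteq> convex hull (C \<union> (cball w r \<union> cball (- w) r))"
  shows "\<not> cball w r \<subseteq> convex hull (C \<union> F)"
proof
  assume sub: "cball w r \<subseteq> convex hull (C \<union> F)"
  have Cc: "convex C" "compact C" and C0: "0 \<in> C"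
    using C symmetric_convex_body_zero_interior[OF C] interior_subset
    by (auto simp: symmetric_convex_body_def)
  have "w \<in> cball w r" using r by simp
  then have "w \<notin> C" using disj by blast
  then obtain a' b' where ab': "a' \<bullet> w < b'" "\<forall>x\<in>C. a' \<bullet> x > b'"
    using separating_hyperplane_closed_point[OF Cc(1) compact_imp_closed[OF Cc(2)]] by blast
  define a b where "a = - a'" and "b = - b'"
  have ab: "a \<bullet> w > b" "\<And>x. x \<in> C \<Longrightarrow> a \<bullet> x < b"
    using ab' by (auto simp: a_def b_def)
  have a0: "a \<noteq> 0" using ab(1) ab(2)[OF C0] by auto
  obtain c where c: "c \<noteq> 0" "orthogonal a c"
    using orthogonal_to_vector_exists[OF dim] by blast
  obtain K where K: "\<And>x. x \<in> C \<Longrightarrow> norm x \<le> K" "K > 0"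
    using compact_imp_bounded[OF Cc(2)] bounded_pos by blast
  \<comment> \<open>On \<open>C\<close> the tilt \<open>t *\<^sub>R c\<close> changes the difference
    of values at \<open>x\<close> and \<open>w\<close> by at most
    \<open>t * norm c * (norm w + K)\<close>; for \<open>t < \<epsilon>\<close> this is below the
    gap \<open>a \<bullet> w - b\<close>.\<close>
  define \<epsilon> where "\<epsilon> = (a \<bullet> w - b) / (norm c * (norm w + K))"
  have \<epsilon>: "\<epsilon> > 0" unfolding \<epsilon>_def using ab(1) c K
    by (intro divide_pos_pos mult_pos_pos add_nonneg_pos) auto
  text \<open>Each functional \<open>\<psi> t\<close> attains its maximum over \<open>C\<close> and the two balls only at \<open>e t\<close>, so \<open>e t\<close> must
    belong to \<open>F\<close>; distinct \<open>t\<close> give distinct points.\<close>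
  define \<psi> where "\<psi> t = a + t *\<^sub>R c" for t :: real
  define e where "e t = w + (r / norm (\<psi> t)) *\<^sub>R \<psi> t" for t
  have \<psi>a: "\<psi> t \<bullet> a = a \<bullet> a" for t
    using c by (simp add: \<psi>_def inner_add_left orthogonal_def inner_commute[of c a])
  have \<psi>0: "\<psi> t \<noteq> 0" for t
    using \<psi>a[of t] a0 by auto
  \<comment> \<open>Because \<open>c\<close> is orthogonal to \<open>a\<close>, the product
    \<open>\<psi> t \<bullet> a\<close> does not depend on \<open>t\<close>. The unit vector along
    \<open>\<psi> t\<close> therefore determines its norm, hence \<open>\<psi> t\<close> and
    \<open>t\<close>.\<close>
  have inj: "inj_on e {0<..<\<epsilon>}"
  proof (rule inj_onI)
    fix s t assume "e s = e t"
    then have eq: "(1 / norm (\<psi> s)) *\<^sub>R \<psi> s = (1 / norm (\<psi> t)) *\<^sub>R \<psi> t"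
      using r by (simp add: e_def divide_inverse flip: scaleR_scaleR)
    then have "(1 / norm (\<psi> s)) * (a \<bullet> a) = (1 / norm (\<psi> t)) * (a \<bullet> a)"
      by (metis \<psi>a inner_scaleR_left)
    then have "norm (\<psi> s) = norm (\<psi> t)" using a0 by simp
    then have "\<psi> s = \<psi> t" using eq \<psi>0[of t] by simp
    then show "s = t" using c by (simp add: \<psi>_def)
  qed
  have "e t \<in> F" if t: "t \<in> {0<..<\<epsilon>}" for t
  proof -
    define h where "h = \<psi> t \<bullet> w + r * norm (\<psi> t)"
    have he: "\<psi> t \<bullet> e t = h"
      using \<psi>0[of t] by (simp add: h_def e_def inner_add_right dot_square_norm power2_eq_square)
    have lt: "\<psi> t \<bullet> x < \<psi> t \<bullet> w" if x: "x \<in> C" for x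
    proof -
      have "c \<bullet> x - c \<bullet> w \<le> norm c * (norm w + K)"
        using Cauchy_Schwarz_ineq2[of c x] Cauchy_Schwarz_ineq2[of c w]
          mult_left_mono[OF K(1)[OF x], of "norm c"] by (simp add: distrib_left)
      then have "t * (c \<bullet> x - c \<bullet> w) \<le> t * (norm c * (norm w + K))"
        using t by (intro mult_left_mono) auto
      also have "\<dots> < \<epsilon> * (norm c * (norm w + K))"
        using t c K by (intro mult_strict_right_mono mult_pos_pos add_nonneg_pos) auto
      also have "\<dots> = a \<bullet> w - b"
        using c add_nonneg_pos[OF norm_ge_zero[of w] K(2)] by (simp add: \<epsilon>_def)
      finally have "t * (c \<bullet> x - c \<bullet> w) < a \<bullet> w - b" .
      moreover have "\<psi> t \<bullet> x - \<psi> t \<bullet> w = (a \<bullet> x - a \<bullet> w) + t * (c \<bullet> x - c \<bullet> w)"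
        by (simp add: \<psi>_def inner_add_left right_diff_distrib)
      ultimately show ?thesis using ab(2)[OF x] by linarith
    qed
    \<comment> \<open>Since \<open>0 \<in> C\<close>, the center \<open>- w\<close> has a negative
      value, which keeps the whole reflected ball strictly below \<open>h\<close>.\<close>
    have w0: "\<psi> t \<bullet> w > 0" using lt[OF C0] by simp
    \<comment> \<open>An open half-space with one boundary point added is still convex; containment
      in \<open>?S\<close> says that \<open>e t\<close> is the only possible maximiser.\<close>
    let ?S = "insert (e t) {x. \<psi> t \<bullet> x < h}"
    have "convex ?S"
    proof (rule convexI)
      fix x y and u v :: real
      assume x: "x \<in> ?S" and y: "y \<in> ?S" and uv: "0 \<le> u" "0 \<le> v" "u + v = 1"
      have le: "\<psi> t \<bullet> x \<le> h" "\<psi> t \<bullet> y \<le> h" using x y he by auto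
      show "u *\<^sub>R x + v *\<^sub>R y \<in> ?S"
      proof (cases "u = 0 \<or> v = 0 \<or> (x = e t \<and> y = e t)")
        case True
        then show ?thesis using x y uv by (auto simp: scaleR_add_left[symmetric])
      next
        case False
        then have "\<psi> t \<bullet> x < h \<or> \<psi> t \<bullet> y < h" "u > 0" "v > 0" using x y uv by auto
        then have "u * (\<psi> t \<bullet> x) + v * (\<psi> t \<bullet> y) < u * h + v * h"
          using le by (metis add_le_less_mono add_less_le_mono mult_le_cancel_left_pos mult_less_cancel_left_pos)
        also have "\<dots> = h" using uv by (metis distrib_right mult_1)
        finally show ?thesis by (simp add: inner_add_right)
      qed
    qed
    moreover have "y \<in> ?S" if y: "y \<in> C \<union> (cball w r \<union> cball (- w) r)" for y
    proof -
      have rn: "r * norm (\<psi> t) > 0" using r \<psi>0[of t] by simp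
      consider "y \<in> C" | "y \<in> cball w r" | "y \<in> cball (- w) r" using y by blast
      then show ?thesis
      proof cases
        case 1
        then show ?thesis using lt[OF 1] rn by (simp add: h_def)
      next
        case 2
        define v where "v = y - w"
        have v: "norm v \<le> r" using 2 by (simp add: v_def dist_norm norm_minus_commute)
        have CS: "\<psi> t \<bullet> v \<le> norm (\<psi> t) * norm v" by (rule norm_cauchy_schwarz)
        have le: "norm (\<psi> t) * norm v \<le> norm (\<psi> t) * r" using v by (intro mult_left_mono) auto
        show ?thesis
        proof (cases "\<psi> t \<bullet> v < r * norm (\<psi> t)")
          case True
          then show ?thesis by (simp add: h_def v_def inner_diff_right)
        next
          case False
          \<comment> \<open>Equality in Cauchy-Schwarz makes \<open>v\<close> the multiple of
            \<open>\<psi> t\<close> of length \<open>r\<close>, so \<open>y = e t\<close>.\<close>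
          then have "\<psi> t \<bullet> v = norm (\<psi> t) * norm v" "norm (\<psi> t) * norm v = norm (\<psi> t) * r"
            using CS le unfolding mult.commute[of r] by linarith+
          then have "\<psi> t \<bullet> v = norm (\<psi> t) * norm v" "norm v = r" using \<psi>0[of t] by simp_all
          then have "norm (\<psi> t) *\<^sub>R v = r *\<^sub>R \<psi> t"
            using norm_cauchy_schwarz_eq[of "\<psi> t" v] by simp
          then have "(1 / norm (\<psi> t)) *\<^sub>R (norm (\<psi> t) *\<^sub>R v) = (1 / norm (\<psi> t)) *\<^sub>R (r *\<^sub>R \<psi> t)"
            by simp
          then have "v = (r / norm (\<psi> t)) *\<^sub>R \<psi> t"
            using \<psi>0[of t] by simp
          moreover have "y = w + v" by (simp add: v_def)
          ultimately show ?thesis by (simp add: e_def)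
        qed
      next
        case 3
        then have "norm (- w - y) \<le> r" by (simp only: mem_cball dist_norm)
        moreover have "- w - y = - (y + w)" by simp
        ultimately have "norm (y + w) \<le> r" by (simp only: norm_minus_cancel)
        then have "norm (\<psi> t) * norm (y + w) \<le> norm (\<psi> t) * r" by (intro mult_left_mono) auto
        then have "\<psi> t \<bullet> (y + w) \<le> r * norm (\<psi> t)"
          using norm_cauchy_schwarz[of "\<psi> t" "y + w"] by (simp add: mult.commute)
        then show ?thesis using w0 by (simp add: h_def inner_add_right)
      qed
    qed
    ultimately have hull: "convex hull (C \<union> (cball w r \<union> cball (- w) r)) \<subseteq> ?S"
      by (intro hull_minimal subsetI)
    have "dist w (e t) = r" using r \<psi>0[of t] by (simp add: e_def dist_norm)
    then have "e t \<in> convex hull (C \<union> F)" using sub by auto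
    \<comment> \<open>If all of \<open>F\<close> were strictly below \<open>h\<close>, so would be
      the hull containing \<open>e t\<close>. Hence some \<open>v \<in> F\<close> reaches
      \<open>h\<close>, and \<open>v \<in> ?S\<close> leaves only \<open>v = e t\<close>.\<close>
    moreover have "convex hull (C \<union> F) \<subseteq> {x. \<psi> t \<bullet> x < h}" if "\<And>v. v \<in> F \<Longrightarrow> \<psi> t \<bullet> v < h"
    proof (intro hull_minimal convex_halfspace_lt)
      have "r * norm (\<psi> t) > 0" using r \<psi>0[of t] by simp
      then show "C \<union> F \<subseteq> {x. \<psi> t \<bullet> x < h}" using that lt by (force simp: h_def)
    qed
    ultimately obtain v where "v \<in> F" "\<not> \<psi> t \<bullet> v < h" using he by blast
    then show ?thesis using F(2) hull by auto
  qed
  then have "e ` {0<..<\<epsilon>} \<subseteq> F" by blast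
  then show False
    using finite_subset[OF _ F(1)] finite_imageD[OF _ inj] infinite_Ioo[OF \<epsilon>] by blast
qed

section \<open>Determinants, and the area of isometric bodies\<close>

definition det2 :: "real^2 \<Rightarrow> real^2 \<Rightarrow> real" where
  "det2 x y = x $ 1 * y $ 2 - x $ 2 * y $ 1"

lemma det2_linear:
  assumes "linear T"
  shows "det2 (T x) (T y) = det (matrix T) * det2 x y"
proof -
  have "det2 (A *v x) (A *v y) = det A * det2 x y" for A :: "real^2^2"
    by (simp add: det2_def det_2 matrix_vector_mult_def sum_2 algebra_simps)
  then have "det2 (matrix T *v x) (matrix T *v y) = det (matrix T) * det2 x y" .
  then show ?thesis
    using assms by (simp add: matrix_works)
qed

text \<open>The isometry \<open>T\<close> multiplies \<open>\<bar>det2\<bar>\<close> by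
  \<open>\<delta>\<close>. The images of \<open>p\<close> and \<open>q\<close> lie in
  \<open>Y\<close>, so maximality over \<open>Z\<close> gives \<open>\<delta> \<le> 1\<close>; their
  preimages lie in \<open>X\<close>, so it also gives \<open>\<delta> \<ge> 1\<close>. Thus
  \<open>T\<close> preserves area.\<close>

lemma isometric_imp_measure_eq:
  fixes X Y :: "(real^2) set"
  assumes X: "symmetric_convex_body X" and Y: "symmetric_convex_body Y"
    and iso: "isometric (body_norm X) (body_norm Y)"
    and sub: "X \<subseteq> Z" "Y \<subseteq> Z" and pq: "p \<in> X" "q \<in> X" "p \<in> Y" "q \<in> Y"
    and max: "\<And>x y. x \<in> Z \<Longrightarrow> y \<in> Z \<Longrightarrow> \<bar>det2 x y\<bar> \<le> \<bar>det2 p q\<bar>"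
    and pos: "det2 p q \<noteq> 0"
  shows "measure lebesgue X = measure lebesgue Y"
proof -
  obtain T where T: "linear T" "T ` X = Y"
    using isometricD_image[OF X Y iso] .
  define \<delta> where "\<delta> = \<bar>det (matrix T)\<bar>"
  have D: "\<bar>det2 (T x) (T y)\<bar> = \<delta> * \<bar>det2 x y\<bar>" for x y
    by (simp add: det2_linear[OF T(1)] \<delta>_def abs_mult)
  have "\<delta> * \<bar>det2 p q\<bar> \<le> 1 * \<bar>det2 p q\<bar>"
    using max[of "T p" "T q"] T(2) pq sub by (auto simp: D[symmetric])
  then have le: "\<delta> \<le> 1" using pos by simp
  obtain a b where ab: "a \<in> X" "b \<in> X" "p = T a" "q = T b"
    using T(2) pq by blast
  have "1 * \<bar>det2 p q\<bar> = \<delta> * \<bar>det2 a b\<bar>" using D ab by simp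
  also have "\<dots> \<le> \<delta> * \<bar>det2 p q\<bar>"
    using max[of a b] ab sub by (intro mult_left_mono) (auto simp: \<delta>_def)
  finally have "1 * \<bar>det2 p q\<bar> \<le> \<delta> * \<bar>det2 p q\<bar>" .
  moreover have "0 < \<bar>det2 p q\<bar>" using pos by simp
  ultimately have "1 \<le> \<delta>" by (rule mult_right_le_imp_le)
  then have "\<delta> = 1" using le by simp
  moreover have "measure lebesgue (T ` X) = \<delta> * measure lebesgue X"
    unfolding \<delta>_def using X T(1)
    by (intro measure_linear_image) (auto simp: symmetric_convex_body_def lmeasurable_compact)
  ultimately show ?thesis using T(2) by simp
qed

lemma det2_attains_max:
  assumes Z: "symmetric_convex_body Z"
  obtains p q where "p \<in> Z" "q \<in> Z" "det2 p q \<noteq> 0"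
    "\<And>x y. x \<in> Z \<Longrightarrow> y \<in> Z \<Longrightarrow> \<bar>det2 x y\<bar> \<le> \<bar>det2 p q\<bar>"
proof -
  obtain e where e: "e > 0" "cball 0 e \<subseteq> Z"
    using symmetric_convex_body_zero_interior[OF Z] mem_interior_cball by blast
  let ?f = "\<lambda>z. \<bar>det2 (fst z) (snd z)\<bar>"
  have "compact (Z \<times> Z)" "Z \<times> Z \<noteq> {}"
    using Z by (auto simp: symmetric_convex_body_def compact_Times)
  moreover have "continuous_on (Z \<times> Z) ?f"
    unfolding det2_def by (intro continuous_intros)
  ultimately obtain z where z: "z \<in> Z \<times> Z" "\<And>y. y \<in> Z \<times> Z \<Longrightarrow> ?f y \<le> ?f z"
    using continuous_attains_sup[of "Z \<times> Z" ?f] by blast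
  \<comment> \<open>A small multiple of the coordinate basis lies in \<open>Z\<close> and makes the
    maximum positive.\<close>
  have "e *\<^sub>R axis i 1 \<in> Z" for i :: 2
    using e by (intro subsetD[OF e(2)]) simp
  then have "?f (e *\<^sub>R axis 1 1, e *\<^sub>R axis 2 1) \<le> ?f z" by (intro z(2)) simp
  moreover have "?f (e *\<^sub>R axis 1 1, e *\<^sub>R axis 2 1) > 0" using e by (simp add: det2_def axis_def)
  ultimately show ?thesis
    using that[of "fst z" "snd z"] z by fastforce
qed

section \<open>Uncountably many non-isometric bodies between two nested ones\<close>

lemma uncountable_nonisometric_between:
  fixes C B :: "(real^2) set"
  assumes C: "symmetric_convex_body C" and B: "symmetric_convex_body B"
    and sub: "C \<subseteq> B" "\<not> B \<subseteq> C"
  obtains \<X> where "\<And>X. X \<in> \<X> \<Longrightarrow> symmetric_convex_body X \<and> C \<subseteq> X \<and> X \<subseteq> B"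
    "uncountable \<X>"
    "pairwise (\<lambda>X Y. \<not> isometric (body_norm X) (body_norm Y)) \<X>"
proof -
  have Cc: "closed C" and Bc: "convex B" "interior B \<noteq> {}" and Bsym: "\<And>x. x \<in> B \<Longrightarrow> - x \<in> B"
    using B C by (auto simp: symmetric_convex_body_def compact_imp_closed)
  obtain w r where wr: "r > 0" "cball w r \<subseteq> B - C"
    using cball_in_Diff[OF Bc Cc sub(2)] .
  define S where "S = cball w r \<union> cball (- w) r"
  have cball_uminus: "- x \<in> cball (- w) r \<longleftrightarrow> x \<in> cball w r" for x w :: "real^2"
    by (simp add: dist_norm norm_minus_commute)
  have S: "compact S" "\<And>x. x \<in> S \<Longrightarrow> - x \<in> S"
    using cball_uminus[of _ w] cball_uminus[of _ "- w"] by (auto simp only: S_def compact_Un compact_cball minus_minus)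
  define Z where "Z = convex hull (C \<union> S)"
  have Z: "symmetric_convex_body Z"
    unfolding Z_def using C S by (rule symmetric_convex_body_hull_Un)
  have "S \<subseteq> B"
  proof
    fix x assume "x \<in> S"
    then have "x \<in> cball w r \<or> - x \<in> cball w r"
      using cball_uminus[of "- x" w] by (auto simp only: S_def minus_minus)
    then show "x \<in> B" using wr(2) Bsym[of "- x"] by auto
  qed
  then have ZB: "Z \<subseteq> B"
    unfolding Z_def using sub Bc by (intro hull_minimal) auto
  obtain p q where pq: "p \<in> Z" "q \<in> Z" "det2 p q \<noteq> 0"
    "\<And>x y. x \<in> Z \<Longrightarrow> y \<in> Z \<Longrightarrow> \<bar>det2 x y\<bar> \<le> \<bar>det2 p q\<bar>"
    using det2_attains_max[OF Z] by metis
  define F where "F = {p, q, - p, - q}"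
  define W where "W = convex hull (C \<union> F)"
  have W: "symmetric_convex_body W"
    unfolding W_def using C by (rule symmetric_convex_body_hull_Un) (auto simp: F_def finite_imp_compact)
  have FZ: "F \<subseteq> Z" using pq Z by (auto simp: F_def symmetric_convex_body_def)
  have CW: "C \<subseteq> W" and FW: "F \<subseteq> W"
    unfolding W_def using hull_subset[of "C \<union> F" convex] by auto
  have "C \<subseteq> Z" "S \<subseteq> Z" unfolding Z_def using hull_subset[of "C \<union> S" convex] by auto
  then have WZ: "W \<subseteq> Z"
    unfolding W_def using Z FZ by (intro hull_minimal) (auto simp: symmetric_convex_body_def)
  have "\<not> cball w r \<subseteq> W"
    unfolding W_def
    by (rule not_cball_subset_hull_finite[OF _ C wr(1)]) (use wr FZ in \<open>auto simp: F_def Z_def S_def\<close>)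
  then obtain z where z: "z \<in> Z" "z \<notin> W"
    using \<open>S \<subseteq> Z\<close> by (auto simp: S_def)
  \<comment> \<open>The chain starts at \<open>X 1 = W\<close> and has taken in \<open>z\<close> at
    \<open>s = N\<close>; it grows strictly on \<open>{1..N}\<close>.\<close>
  define N where "N = body_norm W z"
  have N: "N > 1" using body_norm_le_iff[OF W, of 1 z] z by (auto simp: N_def)
  define X where "X s = Z \<inter> (*\<^sub>R) s ` W" for s :: real
  have X_iff: "x \<in> X s \<longleftrightarrow> x \<in> Z \<and> body_norm W x \<le> s" if "s \<ge> 1" for s x
    using body_norm_le_iff[OF W, of s x] that by (simp add: X_def)
  have X: "symmetric_convex_body (X s)" if "s \<ge> 1" for s
    unfolding X_def using that
    by (intro symmetric_convex_body_Int symmetric_convex_body_scaleR Z W) auto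
  have WX: "W \<subseteq> X s" if "s \<ge> 1" for s
    using X_iff[OF that] WZ body_norm_le_iff[OF W, of 1] that by fastforce
  have XZ: "X s \<subseteq> Z" for s by (auto simp: X_def)
  have less: "measure lebesgue (X s) < measure lebesgue (X t)" if st: "1 \<le> s" "s < t" "t \<le> N" for s t
  proof (rule measure_lebesgue_strict_mono)
    show "compact (X s)" "convex (X t)" "compact (X t)" "interior (X t) \<noteq> {}"
      using X[of s] X[of t] st by (auto simp: symmetric_convex_body_def)
    show "X s \<subseteq> X t" using X_iff st by force
    \<comment> \<open>The segment from 0 to \<open>z\<close> stays in \<open>Z\<close>, and its
      point \<open>(t / N) *\<^sub>R z\<close> has \<open>W\<close>-norm exactly \<open>t\<close>,
      so it is in \<open>X t\<close> but not in \<open>X s\<close>.\<close>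
    have "0 \<in> Z" "convex Z"
      using symmetric_convex_body_zero_interior[OF Z] interior_subset Z
      by (auto simp: symmetric_convex_body_def)
    then have "(1 - t / N) *\<^sub>R 0 + (t / N) *\<^sub>R z \<in> Z"
      using st N z(1) by (intro convexD) auto
    moreover have "body_norm W ((t / N) *\<^sub>R z) = t"
      using st N by (simp add: body_norm_scaleR[OF W]) (simp add: N_def)
    ultimately have "(t / N) *\<^sub>R z \<in> X t - X s" using st by (simp add: X_iff)
    then show "\<not> X t \<subseteq> X s" by blast
  qed
  have noniso: "\<not> isometric (body_norm (X s)) (body_norm (X t))"
    if "s \<in> {1..N}" "t \<in> {1..N}" "s \<noteq> t" for s t
  proof
    assume iso: "isometric (body_norm (X s)) (body_norm (X t))"
    have st: "s \<ge> 1" "t \<ge> 1" using that by auto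
    have "measure lebesgue (X s) = measure lebesgue (X t)"
      using FW WX[OF st(1)] WX[OF st(2)]
      by (intro isometric_imp_measure_eq[OF X[OF st(1)] X[OF st(2)] iso XZ XZ _ _ _ _ pq(4,3)])
        (auto simp: F_def)
    then show False using less[of s t] less[of t s] that by (cases "s < t") auto
  qed
  have "inj_on X {1..N}" using less by (intro linorder_inj_onI) force+
  then have "uncountable (X ` {1..N})"
    using uncountable_closed_interval[of 1 N] N countable_image_inj_on by blast
  moreover have "symmetric_convex_body Y \<and> C \<subseteq> Y \<and> Y \<subseteq> B" if "Y \<in> X ` {1..N}" for Y
    using that X WX XZ ZB CW by fastforce
  moreover have "pairwise (\<lambda>X Y. \<not> isometric (body_norm X) (body_norm Y)) (X ` {1..N})"
    using noniso by (intro pairwise_imageI) auto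
  ultimately show ?thesis using that by blast
qed

section \<open>Sign of the Banach-Mazur distance\<close>

text \<open>This serves to get \<open>d > 0\<close>. Real \<open>Sup\<close> and \<open>Inf\<close>
  are informative only on bounded nonempty sets: compactness of the ball bounds each supremum, the
  origin contributes the value 0, and the identity makes the infimum range over a nonempty
  set.\<close>

lemma banach_mazur_nonneg:
  fixes B C :: "'a::euclidean_space set"
  assumes B: "symmetric_convex_body B" and C: "symmetric_convex_body C"
  shows "banach_mazur (body_norm B) (body_norm C) \<ge> 0"
proof -
  have op: "operator_norm (body_norm B) (body_norm C) T \<ge> 0"
    if B: "symmetric_convex_body B" and C: "symmetric_convex_body C" and T: "linear T"
    for B C :: "'a set" and T
  proof -
    have "{body_norm C (T x) | x. body_norm B x \<le> 1} = (body_norm C \<circ> T) ` B"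
      using body_norm_ball[OF B] by auto
    moreover have "compact ((body_norm C \<circ> T) ` B)"
      using B T continuous_on_subset[OF continuous_on_body_norm[OF C]]
      by (intro compact_continuous_image continuous_on_compose)
        (auto simp: symmetric_convex_body_def linear_continuous_on linear_conv_bounded_linear)
    then have "bdd_above ((body_norm C \<circ> T) ` B)"
      by (intro bounded_imp_bdd_above compact_imp_bounded)
    moreover have "0 \<in> (body_norm C \<circ> T) ` B"
      using symmetric_convex_body_zero_interior[OF B] interior_subset[of B] T
        body_norm_eq_0_iff[OF C, of 0]
      by (intro image_eqI[of _ _ 0]) (auto simp: linear_0)
    ultimately show ?thesis unfolding operator_norm_def by (metis cSup_upper)
  qed
  have "linear (id :: 'a \<Rightarrow> 'a)" "inj (id :: 'a \<Rightarrow> 'a)" "surj (id :: 'a \<Rightarrow> 'a)"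
    by (simp_all add: linear_id)
  then have "\<exists>T :: 'a \<Rightarrow> 'a. inj T \<and> linear T \<and> surj T" by blast
  then show ?thesis
    unfolding banach_mazur_def
    by (intro cInf_greatest)
      (auto simp: bij_def intro!: mult_nonneg_nonneg op B C inj_linear_imp_inv_linear)
qed

section \<open>The two bodies of the theorem are nested and distinct\<close>

theorem theorem3:
  fixes B\<^sub>E B\<^sub>F :: "(real^2) set" and d l :: real
  assumes "symmetric_convex_body B\<^sub>E" and "symmetric_convex_body B\<^sub>F"
    and "\<not> isometric (body_norm B\<^sub>E) (body_norm B\<^sub>F)"
    and "d = banach_mazur (body_norm B\<^sub>E) (body_norm B\<^sub>F)"
    and "B\<^sub>E \<subseteq> B\<^sub>F" and "B\<^sub>F \<subseteq> (*\<^sub>R) d ` B\<^sub>E"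
    and "0 < l" and "l < 1"
  shows "\<exists>\<X> :: (real^2) set set.
    (\<forall>B\<in>\<X>. symmetric_convex_body B \<and>
      convex hull (B\<^sub>E \<union> (*\<^sub>R) (1 / d powr (1 - l)) ` B\<^sub>F) \<subseteq> B \<and>
      B \<subseteq> (*\<^sub>R) (d powr l) ` B\<^sub>E \<inter> B\<^sub>F) \<and>
    uncountable \<X> \<and>
    pairwise (\<lambda>B C. \<not> isometric (body_norm B) (body_norm C)) \<X>"
proof -
  note E = assms(1) and F = assms(2)
  define nE nF where "nE = body_norm B\<^sub>E" and "nF = body_norm B\<^sub>F"
  define D k where "D = d powr l" and "k = 1 / d powr (1 - l)"
  \<comment> \<open>Only homotheties have to be excluded: \<open>c = 1\<close> when the norms agree,
    and \<open>c = d\<close> when \<open>B\<^sub>F\<close> is \<open>d\<close> times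
    \<open>B\<^sub>E\<close>.\<close>
  have not_iso: "\<not> (\<forall>x. nF (c *\<^sub>R x) = nE x)" if "c \<noteq> 0" for c
  proof
    assume "\<forall>x. nF (c *\<^sub>R x) = nE x"
    moreover have "linear ((*\<^sub>R) c :: real^2 \<Rightarrow> _)" by (rule linear_scaleR)
    moreover have "bij ((*\<^sub>R) c :: real^2 \<Rightarrow> _)"
      using that by (intro bij_betw_byWitness[where f' = "(*\<^sub>R) (inverse c)"]) auto
    ultimately show False using assms(3) unfolding isometric_def nE_def nF_def by blast
  qed
  have nF_le_nE: "nF x \<le> nE x" for x
    unfolding nE_def nF_def by (rule body_norm_antimono[OF E F assms(5)])
  have "d \<noteq> 0"
  proof
    assume "d = 0"
    then have "B\<^sub>F \<subseteq> {0}" using assms(6) by auto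
    then have "interior B\<^sub>F \<subseteq> interior {0}" by (rule interior_mono)
    then show False using F by (auto simp: symmetric_convex_body_def)
  qed
  then have d0: "d > 0" using banach_mazur_nonneg[OF E F] assms(4) by simp
  have nE_le_nF: "nE x \<le> d * nF x" for x
  proof -
    have "body_norm ((*\<^sub>R) d ` B\<^sub>E) x \<le> nF x"
      unfolding nF_def by (rule body_norm_antimono[OF F symmetric_convex_body_scaleR[OF E d0] assms(6)])
    moreover have "nE x / d \<le> body_norm ((*\<^sub>R) d ` B\<^sub>E) x"
    proof (rule dense_ge)
      fix s assume s: "s > body_norm ((*\<^sub>R) d ` B\<^sub>E) x"
      then have s0: "s > 0" using body_norm_nonneg[OF symmetric_convex_body_scaleR[OF E d0], of x] by simp
      then have "x \<in> (*\<^sub>R) s ` (*\<^sub>R) d ` B\<^sub>E"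
        using body_norm_le_iff[OF symmetric_convex_body_scaleR[OF E d0] s0, of x] s by simp
      then have "x \<in> (*\<^sub>R) (s * d) ` B\<^sub>E" by (simp add: image_image)
      then have "nE x \<le> s * d"
        using body_norm_le_iff[OF E, of "s * d"] s0 d0 by (simp add: nE_def)
      then show "nE x / d \<le> s" using d0 by (simp add: divide_simps)
    qed
    ultimately have "nE x / d \<le> nF x" by linarith
    then show ?thesis using d0 by (simp add: divide_simps mult.commute)
  qed
  \<comment> \<open>Otherwise \<open>nE \<le> d * nF \<le> nF \<le> nE\<close>, and the identity is
    an isometry.\<close>
  have "d > 1"
  proof (rule ccontr)
    assume "\<not> d > 1"
    then have "nE x \<le> nF x" for x
      using nE_le_nF[of x] body_norm_nonneg[OF F, of x] mult_right_mono[of d 1 "nF x"]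
      by (simp add: nF_def)
    then show False using not_iso[of 1] nF_le_nE by (auto intro: antisym)
  qed
  then have D1: "D > 1" and k: "0 < k" "k < 1"
    using assms(7,8) by (auto simp: D_def k_def)
  \<comment> \<open>The exponents add up to 1, so scaling
    \<open>B\<^sub>F \<subseteq> d B\<^sub>E\<close> by \<open>k\<close> gives
    \<open>k B\<^sub>F \<subseteq> D B\<^sub>E\<close>, as needed for
    \<open>C \<subseteq> B\<close>.\<close>
  have "d powr l * d powr (1 - l) = d" using d0 by (simp flip: powr_add)
  then have dk: "d * k = D"
    using d0 by (simp add: D_def k_def field_simps)
  have E_iff: "x \<in> B\<^sub>E \<longleftrightarrow> nE x \<le> 1" and F_iff: "x \<in> B\<^sub>F \<longleftrightarrow> nF x \<le> 1"
    and DE_iff: "x \<in> (*\<^sub>R) D ` B\<^sub>E \<longleftrightarrow> nE x \<le> D" and kF_iff: "x \<in> (*\<^sub>R) k ` B\<^sub>F \<longleftrightarrow> nF x \<le> k" for x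
    using body_norm_le_iff[OF E, of 1 x] body_norm_le_iff[OF F, of 1 x]
      body_norm_le_iff[OF E, of D x] body_norm_le_iff[OF F, of k x] D1 k
    by (auto simp: nE_def nF_def)
  have scale: "nE (c *\<^sub>R x) = \<bar>c\<bar> * nE x" "nF (c *\<^sub>R x) = \<bar>c\<bar> * nF x" for c x
    using body_norm_scaleR[OF E] body_norm_scaleR[OF F] by (simp_all add: nE_def nF_def)
  have pos: "nE x > 0" "nF x > 0" if "x \<noteq> 0" for x
    using body_norm_nonneg[OF E, of x] body_norm_nonneg[OF F, of x] that
      body_norm_eq_0_iff[OF E, of x] body_norm_eq_0_iff[OF F, of x] by (auto simp: nE_def nF_def)
  define C where "C = convex hull (B\<^sub>E \<union> (*\<^sub>R) k ` B\<^sub>F)"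
  define B where "B = (*\<^sub>R) D ` B\<^sub>E \<inter> B\<^sub>F"
  have kF: "symmetric_convex_body ((*\<^sub>R) k ` B\<^sub>F)" and DE: "symmetric_convex_body ((*\<^sub>R) D ` B\<^sub>E)"
    using symmetric_convex_body_scaleR[OF F k(1)] symmetric_convex_body_scaleR[OF E, of D] D1 by auto
  have C: "symmetric_convex_body C"
    unfolding C_def using kF by (intro symmetric_convex_body_hull_Un E) (auto simp: symmetric_convex_body_def)
  have B: "symmetric_convex_body B"
    unfolding B_def by (intro symmetric_convex_body_Int DE F)
  have B_iff: "x \<in> B \<longleftrightarrow> nE x \<le> D \<and> nF x \<le> 1" for x
    by (simp add: B_def DE_iff F_iff)
  have "B\<^sub>E \<union> (*\<^sub>R) k ` B\<^sub>F \<subseteq> B"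
  proof
    fix x assume "x \<in> B\<^sub>E \<union> (*\<^sub>R) k ` B\<^sub>F"
    then show "x \<in> B"
    proof
      assume "x \<in> B\<^sub>E"
      then show ?thesis using nF_le_nE[of x] D1 by (simp add: E_iff B_iff)
    next
      assume "x \<in> (*\<^sub>R) k ` B\<^sub>F"
      then have "nF x \<le> k" by (simp add: kF_iff)
      then show ?thesis
        using nE_le_nF[of x] mult_left_mono[of "nF x" k d] d0 dk k by (simp add: B_iff)
    qed
  qed
  then have CB: "C \<subseteq> B"
    unfolding C_def using B by (intro hull_minimal) (auto simp: symmetric_convex_body_def)
  \<comment> \<open>Write \<open>z\<close> as a convex combination of
    \<open>a \<in> B\<^sub>E\<close> and \<open>b \<in> k B\<^sub>F\<close>. Since
    \<open>nF b \<le> k < 1\<close>, the value \<open>nF z = 1\<close> leaves no weight on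
    \<open>b\<close>; since \<open>nE a \<le> 1 < D\<close>, the value \<open>nE z = D\<close>
    leaves none on \<open>a\<close>.\<close>
  have contact: "nF z = 1 \<longrightarrow> nE z \<le> 1" "nE z = D \<longrightarrow> nF z \<le> k" if "z \<in> C" for z
  proof -
    have "B\<^sub>E \<noteq> {}" "(*\<^sub>R) k ` B\<^sub>F \<noteq> {}" "convex B\<^sub>E" "convex ((*\<^sub>R) k ` B\<^sub>F)"
      using E F kF by (auto simp: symmetric_convex_body_def)
    then obtain u v a b where ab: "a \<in> B\<^sub>E" "b \<in> (*\<^sub>R) k ` B\<^sub>F"
      and uv: "u \<ge> 0" "v \<ge> 0" "u + v = 1" and z: "z = u *\<^sub>R a + v *\<^sub>R b"
      using \<open>z \<in> C\<close> convex_hull_union_two[of "B\<^sub>E" "(*\<^sub>R) k ` B\<^sub>F"] unfolding C_def by blast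
    have a: "nE a \<le> 1" "nF a \<le> 1" using ab(1) nF_le_nE[of a] by (auto simp: E_iff)
    have b: "nF b \<le> k" using ab(2) by (simp add: kF_iff)
    then have b': "nE b \<le> D"
      using nE_le_nF[of b] mult_left_mono[of "nF b" k d] d0 dk by simp
    have "nF z \<le> nF (u *\<^sub>R a) + nF (v *\<^sub>R b)" "nE z \<le> nE (u *\<^sub>R a) + nE (v *\<^sub>R b)"
      using body_norm_triangle[OF F] body_norm_triangle[OF E] by (simp_all add: z nE_def nF_def)
    then have z_le: "nF z \<le> u * nF a + v * nF b" "nE z \<le> u * nE a + v * nE b"
      using uv by (simp_all add: scale)
    have "u * nF a \<le> u * 1" "v * nF b \<le> v * k" "u * nE a \<le> u * 1" "v * nE b \<le> v * D"
      by (intro mult_left_mono a b b' uv)+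
    then have z_le': "nF z \<le> u + v * k" "nE z \<le> u + v * D" using z_le by auto
    show "nF z = 1 \<longrightarrow> nE z \<le> 1"
    proof
      assume "nF z = 1"
      then have "v * (1 - k) \<le> 0" using z_le'(1) uv by (simp add: algebra_simps)
      then have "v = 0" using k uv by (simp add: mult_le_0_iff)
      then show "nE z \<le> 1" using z_le'(2) uv by simp
    qed
    show "nE z = D \<longrightarrow> nF z \<le> k"
    proof
      assume "nE z = D"
      moreover have "v = 1 - u" using uv by simp
      ultimately have "D \<le> u + (1 - u) * D" using z_le'(2) by simp
      then have "u * (D - 1) \<le> 0" by (simp add: algebra_simps)
      then have "u = 0" using D1 uv by (simp add: mult_le_0_iff)
      then show "nF z \<le> k" using z_le'(1) uv by simp
    qed
  qed
  have "\<not> B \<subseteq> C"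
  proof
    assume BC: "B \<subseteq> C"
    \<comment> \<open>The sign of \<open>g x\<close> tells which of the two constraints defining
      \<open>B\<close> is met first along the ray through \<open>x\<close>; at a zero both are tight
      at once, which \<open>contact\<close> forbids.\<close>
    define g where "g x = D * nF x - nE x" for x
    have g0: "g x \<noteq> 0" if x: "x \<noteq> 0" for x
    proof
      assume "g x = 0"
      define z where "z = inverse (nF x) *\<^sub>R x"
      have "nF z = 1" "nE z = D"
        using \<open>g x = 0\<close> pos[OF x] by (simp_all add: z_def scale g_def field_simps)
      moreover from this have "z \<in> C" using BC B_iff[of z] by auto
      ultimately show False using contact[of z] D1 by simp
    qed
    have "connected (g ` (- {0}))"
      unfolding g_def nE_def nF_def
      by (intro connected_continuous_image connected_punctured_universe continuous_intros
          continuous_on_subset[OF continuous_on_body_norm] E F) auto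
    then have "is_interval (g ` (- {0}))" by (simp add: is_interval_connected_1)
    then have between: "0 \<in> g ` (- {0})" if "x \<noteq> 0" "y \<noteq> 0" "g x \<le> 0" "0 \<le> g y" for x y
      using that unfolding is_interval_1 by blast
    have "0 \<notin> g ` (- {0})" using g0 by force
    then have "(\<forall>x. x \<noteq> 0 \<longrightarrow> g x > 0) \<or> (\<forall>x. x \<noteq> 0 \<longrightarrow> g x < 0)"
      using between by (meson not_le)
    then show False
    proof
      assume g: "\<forall>x. x \<noteq> 0 \<longrightarrow> g x > 0"
      \<comment> \<open>Here \<open>B\<close> is \<open>B\<^sub>F\<close>: every vector with
        \<open>nF z = 1\<close> lies in \<open>C\<close>, so \<open>contact\<close> gives
        \<open>nE z \<le> 1\<close>.\<close>
      have "nF x = nE x" if x: "x \<noteq> 0" for x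
      proof -
        define z where "z = inverse (nF x) *\<^sub>R x"
        have z: "nF z = 1" "nE z = nE x / nF x" using pos[OF x] by (simp_all add: z_def scale field_simps)
        have "nE x < D * nF x" using g x by (simp add: g_def)
        then have "nE z \<le> D" using pos[OF x] unfolding z(2) by (simp add: divide_simps)
        then have "z \<in> C" using BC z(1) B_iff[of z] by auto
        then have "nE z \<le> 1" using contact z(1) by blast
        then show ?thesis using z(2) pos[OF x] nF_le_nE[of x] by (simp add: field_simps)
      qed
      then have "\<forall>x. nF (1 *\<^sub>R x) = nE x"
        using scale[of 0 0] by (metis scaleR_one scaleR_zero_left abs_zero mult_zero_left)
      then show False using not_iso[of 1] by simp
    next
      assume g: "\<forall>x. x \<noteq> 0 \<longrightarrow> g x < 0"
      \<comment> \<open>Here \<open>B\<close> is \<open>D B\<^sub>E\<close>: every vector with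
        \<open>nE z = D\<close> lies in \<open>C\<close>, so \<open>contact\<close> gives
        \<open>nF z \<le> k\<close>, and \<open>D = d * k\<close> turns this into
        \<open>d * nF x \<le> nE x\<close>.\<close>
      have "nF (d *\<^sub>R x) = nE x" if x: "x \<noteq> 0" for x
      proof -
        define z where "z = (D / nE x) *\<^sub>R x"
        have z: "nE z = D" "nF z = D * nF x / nE x" using pos[OF x] D1 by (simp_all add: z_def scale)
        have "D * nF x < nE x" using g x by (simp add: g_def)
        then have "nF z \<le> 1" using pos[OF x] unfolding z(2) by (simp add: divide_simps)
        then have "z \<in> C" using BC z(1) B_iff[of z] by auto
        then have "nF z \<le> k" using contact z(1) by blast
        then have "d * k * nF x \<le> k * nE x" using z(2) pos[OF x] dk by (simp add: field_simps)
        then have "d * nF x \<le> nE x" using k(1) by (simp add: mult.commute mult.left_commute)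
        then show ?thesis using nE_le_nF[of x] d0 by (simp add: scale)
      qed
      then have "\<forall>x. nF (d *\<^sub>R x) = nE x"
        using scale[of 0 0] by (metis scaleR_zero_right scaleR_zero_left abs_zero mult_zero_left)
      then show False using not_iso[of d] d0 by simp
    qed
  qed
  from uncountable_nonisometric_between[OF C B CB this] show ?thesis
    unfolding C_def B_def D_def k_def by metis
qed

end
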